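(* Let $V$ be a finite non-empty set, $p:2^V\to\mathbb{Z}$ a (fully) supermodular finite-valued function with $p(\emptyset)=0$, $B=\{x\in\mathbb{R}^V:\widetilde x(V)=p(V),\ \widetilde x(Z)\ge p(Z)\ \forall Z\subseteq V\}$, and let $f,g:V\to\mathbb{Z}$ with $f\le g$ be such that $B\cap T(f,g)\cap\mathbb{Z}^V\ne\emptyset$, where $T(f,g)=\{x: f\le x\le g\}$. Let $T\subseteq V$. Then there exist integral $f',g'$ with $T(f',g')\subseteq T(f,g)$ and a subset $X_T\subseteq V$ such that an element $m\in B\cap T(f,g)\cap\mathbb{Z}^V$ minimizes $\widetilde m(T)$ over $B\cap T(f,g)\cap\mathbb{Z}^V$ if and only if $\widetilde m(X_T)=p(X_T)$ and $m\in B\cap T(f',g')\cap\mathbb{Z}^V$.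
   Context: $\widetilde x(Z)=\sum_{v\in Z}x(v)$. *)

theory Defs
  imports Complex_Main "HOL-Library.FuncSet"
begin

text \<open>
  A vector in $R^V$ is a function in \<open>V \<rightarrow>\<^sub>E UNIV\<close>, so that it is determined by its values on \<open>V\<close>.
  The sum of \<open>x\<close> over \<open>Z\<close> is the library term \<open>sum x Z\<close>. Set functions and integral bounds are
  total functions of which only the values on subsets, respectively elements, of \<open>V\<close> matter.
\<close>

definition supermodular_on :: "'a set \<Rightarrow> ('a set \<Rightarrow> int) \<Rightarrow> bool" where
  "supermodular_on V p \<longleftrightarrow>
     (\<forall>X Y. X \<subseteq> V \<longrightarrow> Y \<subseteq> V \<longrightarrow> p X + p Y \<le> p (X \<inter> Y) + p (X \<union> Y))"

definition base_polyhedron :: "'a set \<Rightarrow> ('a set \<Rightarrow> int) \<Rightarrow> ('a \<Rightarrow> real) set" where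
  "base_polyhedron V p =
     {x \<in> V \<rightarrow>\<^sub>E UNIV. sum x V = of_int (p V) \<and> (\<forall>Z. Z \<subseteq> V \<longrightarrow> sum x Z \<ge> of_int (p Z))}"

definition box_between :: "'a set \<Rightarrow> ('a \<Rightarrow> int) \<Rightarrow> ('a \<Rightarrow> int) \<Rightarrow> ('a \<Rightarrow> real) set" where
  "box_between V f g =
     {x \<in> V \<rightarrow>\<^sub>E UNIV. \<forall>v\<in>V. of_int (f v) \<le> x v \<and> x v \<le> of_int (g v)}"

definition integral_vectors :: "'a set \<Rightarrow> ('a \<Rightarrow> real) set" where
  "integral_vectors V = V \<rightarrow>\<^sub>E \<int>"

end

theory Submission
  imports Defs
begin

text \<open>
  Every feasible \<open>m\<close> and every \<open>X \<subseteq> V\<close> satisfy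
  \<open>m(T) = m(X) + m(T - X) - m(X - T) \<ge> p(X) + f(T - X) - g(X - T)\<close>.
  If some feasible vector attains equality for a particular \<open>X\<close>, then the minimizers are exactly the
  feasible \<open>m\<close> for which \<open>X\<close> is tight, \<open>m = f\<close> on \<open>T - X\<close> and \<open>m = g\<close> on \<open>X - T\<close>; the last two
  conditions say that \<open>m\<close> lies in a smaller box.
  To obtain \<open>X\<close>, fix a minimizer \<open>m\<close>. For \<open>v \<in> T\<close> with \<open>m(v) > f(v)\<close> and \<open>u \<in> V - T\<close> with
  \<open>m(u) < g(u)\<close>, moving one unit from \<open>v\<close> to \<open>u\<close> must leave the base polyhedron, so by integrality
  some tight set contains \<open>v\<close> but not \<open>u\<close>. Tight sets form a lattice by supermodularity, and hence
  a single tight \<open>X\<close> contains all such \<open>v\<close> and none of the \<open>u\<close>.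
\<close>

text \<open>For fixed \<open>v\<close>, intersecting the separating sets over all
  \<open>u \<in> U\<close> gives a member that contains \<open>v\<close> and avoids
  \<open>U\<close>; the union of these members over \<open>v \<in> S\<close> is the required set.
  \<open>V\<close> and \<open>{}\<close> start the two inductions.\<close>

lemma lattice_family_separation:
  assumes "finite S" "finite U" "S \<subseteq> V"
    and "{} \<in> F" "V \<in> F"
    and inter: "\<And>X Y. X \<in> F \<Longrightarrow> Y \<in> F \<Longrightarrow> X \<inter> Y \<in> F"
    and union: "\<And>X Y. X \<in> F \<Longrightarrow> Y \<in> F \<Longrightarrow> X \<union> Y \<in> F"
    and sep: "\<And>v u. v \<in> S \<Longrightarrow> u \<in> U \<Longrightarrow> \<exists>Z\<in>F. v \<in> Z \<and> u \<notin> Z"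
  shows "\<exists>X\<in>F. S \<subseteq> X \<and> X \<inter> U = {}"
proof -
  have point: "\<exists>X\<in>F. v \<in> X \<and> X \<inter> U = {}" if "v \<in> S" for v
    using \<open>finite U\<close> sep[OF that]
  proof (induction U rule: finite_induct)
    case empty
    then show ?case using that assms by auto
  next
    case (insert u U)
    then obtain X Z where "X \<in> F" "v \<in> X" "X \<inter> U = {}" "Z \<in> F" "v \<in> Z" "u \<notin> Z"
      by (metis insertCI)
    then show ?case using inter by (intro bexI[of _ "X \<inter> Z"]) auto
  qed
  show ?thesis
    using \<open>finite S\<close> point
  proof (induction S rule: finite_induct)
    case empty
    then show ?case using assms by auto
  next
    case (insert v S)
    then obtain X Z where "X \<in> F" "S \<subseteq> X" "X \<inter> U = {}" "Z \<in> F" "v \<in> Z" "Z \<inter> U = {}"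
      by (metis insertCI)
    then show ?case using union by (intro bexI[of _ "X \<union> Z"]) auto
  qed
qed

text \<open>Uncrossing: p(X) + p(Y) \<le> p(X \<inter> Y) + p(X \<union> Y) \<le> x(X \<inter> Y) +
  x(X \<union> Y) = x(X) + x(Y), and tightness of \<open>X\<close> and \<open>Y\<close> makes both
  ends equal. Hence neither of the two middle sets has slack.\<close>

lemma tight_inter_union:
  assumes "finite V" "supermodular_on V p" "x \<in> base_polyhedron V p"
    and "X \<subseteq> V" "Y \<subseteq> V" "sum x X = of_int (p X)" "sum x Y = of_int (p Y)"
  shows "sum x (X \<inter> Y) = of_int (p (X \<inter> Y))" "sum x (X \<union> Y) = of_int (p (X \<union> Y))"
proof -
  have "sum x (X \<union> Y) + sum x (X \<inter> Y) = sum x X + sum x Y"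
    using assms by (intro sum.union_inter) (auto intro: finite_subset)
  moreover have "p X + p Y \<le> p (X \<inter> Y) + p (X \<union> Y)"
    using assms unfolding supermodular_on_def by blast
  then have "of_int (p X) + of_int (p Y) \<le> (of_int (p (X \<inter> Y)) + of_int (p (X \<union> Y)) :: real)"
    by (metis of_int_add of_int_le_iff)
  moreover have "sum x (X \<inter> Y) \<ge> of_int (p (X \<inter> Y))" "sum x (X \<union> Y) \<ge> of_int (p (X \<union> Y))"
    using assms unfolding base_polyhedron_def by (simp_all add: le_infI1)
  ultimately show "sum x (X \<inter> Y) = of_int (p (X \<inter> Y))" "sum x (X \<union> Y) = of_int (p (X \<union> Y))"
    using assms(6,7) by linarith+
qed

lemma sum_integral_vector:
  assumes "x \<in> integral_vectors V" "Z \<subseteq> V"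
  shows "sum x Z \<in> \<int>"
  using assms unfolding integral_vectors_def by (intro Ints_sum) (auto dest: PiE_mem)

text \<open>On \<open>Q\<close> the objective is integer-valued and bounded below by f(T), so the
  well-ordering of the naturals yields a minimizer.\<close>

lemma exists_integral_minimizer:
  assumes "finite V" "T \<subseteq> V" "Q \<noteq> {}" "Q \<subseteq> box_between V f g \<inter> integral_vectors V"
  shows "\<exists>m. is_arg_min (\<lambda>x. sum x T) (\<lambda>x. x \<in> Q) m"
proof -
  \<comment> \<open>Subtracting f(T) makes the objective a nonnegative integer on \<open>Q\<close>,
    so there neither \<open>nat\<close> nor the floor changes its value.\<close>
  define h where "h x = nat \<lfloor>sum x T - of_int (sum f T)\<rfloor>" for x :: "'a \<Rightarrow> real"
  have h: "of_nat (h x) = sum x T - of_int (sum f T)" if "x \<in> Q" for x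
  proof -
    have "of_int (sum f T) \<le> sum x T"
      unfolding of_int_sum using assms that by (intro sum_mono) (auto simp: box_between_def)
    moreover have "sum x T - of_int (sum f T) \<in> \<int>"
      using sum_integral_vector[of x V T] assms that by (intro Ints_diff Ints_of_int) auto
    ultimately show ?thesis by (auto simp: h_def elim!: Ints_cases)
  qed
  obtain m where m: "m \<in> Q" "\<And>y. y \<in> Q \<Longrightarrow> h m \<le> h y"
    using ex_has_least_nat[of "\<lambda>x. x \<in> Q" _ h] assms(3) by blast
  have "sum m T \<le> sum y T" if "y \<in> Q" for y
    using h[OF m(1)] h[OF that] m(2)[OF that] by linarith
  then show ?thesis using m(1) unfolding is_arg_min_def by (meson not_less)
qed

lemma sum_transfer_unit:
  fixes m :: "'a \<Rightarrow> real"
  assumes "finite Z" "u \<noteq> v"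
  shows "sum (m(v := m v - 1, u := m u + 1)) Z
    = sum m Z - (if v \<in> Z then 1 else 0) + (if u \<in> Z then 1 else 0)"
proof -
  \<comment> \<open>Since \<open>u \<noteq> v\<close>, the two updates do not overwrite each other
    and become independent indicator terms.\<close>
  have "sum (m(v := m v - 1, u := m u + 1)) Z
      = (\<Sum>z\<in>Z. m z - (if z = v then 1 else 0) + (if z = u then 1 else 0))"
    using assms by (intro sum.cong) auto
  then show ?thesis using assms by (simp add: sum.distrib sum_subtractf)
qed

text \<open>Exchange argument: if no such tight set existed, moving one unit from \<open>v\<close>
  to \<open>u\<close> would give a feasible integral vector with a smaller sum on \<open>T\<close>,
  because \<open>v\<close> lies in \<open>T\<close> and \<open>u\<close> does not.\<close>

lemma tight_set_separates:
  assumes "finite V" "T \<subseteq> V"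
    and min: "is_arg_min (\<lambda>x. sum x T)
        (\<lambda>x. x \<in> base_polyhedron V p \<inter> box_between V f g \<inter> integral_vectors V) m"
    and v: "v \<in> T" "m v > of_int (f v)" and u: "u \<in> V - T" "m u < of_int (g u)"
  shows "\<exists>Z\<subseteq>V. sum m Z = of_int (p Z) \<and> v \<in> Z \<and> u \<notin> Z"
proof (rule ccontr)
  assume no_sep: "\<not> ?thesis"
  define y where "y = m(v := m v - 1, u := m u + 1)"
  have m: "m \<in> base_polyhedron V p" "m \<in> box_between V f g" "m \<in> integral_vectors V"
    using min unfolding is_arg_min_def by auto
  have uv: "u \<noteq> v" "u \<in> V" "v \<in> V" using u v assms by auto
  have sum_y: "sum y Z = sum m Z - (if v \<in> Z then 1 else 0) + (if u \<in> Z then 1 else 0)"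
    if "Z \<subseteq> V" for Z
    unfolding y_def using that assms(1) uv by (intro sum_transfer_unit) (auto intro: finite_subset)
  have ints: "m z \<in> \<int>" if "z \<in> V" for z
    using m(3) that unfolding integral_vectors_def by auto
  have y_ext: "y \<in> V \<rightarrow>\<^sub>E UNIV"
    using m(2) uv unfolding box_between_def y_def by (auto simp: PiE_iff extensional_def)
  have "y \<in> integral_vectors V"
    using m(3) uv ints unfolding integral_vectors_def y_def by (auto simp: PiE_iff extensional_def)
  moreover have "y \<in> box_between V f g"
  proof -
    \<comment> \<open>Between integers, the strict inequalities at \<open>v\<close> and
      \<open>u\<close> leave room for a full unit.\<close>
    obtain a b where ab: "m v = of_int a" "m u = of_int b"
      using ints uv by (metis Ints_cases)
    then have "of_int (f v) \<le> m v - 1" "m u + 1 \<le> of_int (g u)"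
      using v(2) u(2) by simp_all
    then show ?thesis
      using y_ext m(2) unfolding box_between_def y_def by fastforce
  qed
  moreover have "y \<in> base_polyhedron V p"
  proof -
    have "sum y Z \<ge> of_int (p Z)" if Z: "Z \<subseteq> V" for Z
    proof -
      obtain a where a: "sum m Z = of_int a"
        using sum_integral_vector[OF m(3) Z] by (metis Ints_cases)
      have "a \<ge> p Z" using m(1) Z a unfolding base_polyhedron_def by auto
      \<comment> \<open>Only a set containing \<open>v\<close> but not \<open>u\<close> loses a
        unit. It is not tight by \<open>no_sep\<close>, so by integrality its slack is at least 1,
        which covers the loss.\<close>
      moreover have "a \<noteq> p Z" if "v \<in> Z" "u \<notin> Z"
        using no_sep that Z a by auto
      ultimately have "a - (if v \<in> Z then 1 else 0) + (if u \<in> Z then 1 else 0) \<ge> p Z"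
        by auto
      then have "(of_int (a - (if v \<in> Z then 1 else 0) + (if u \<in> Z then 1 else 0)) :: real)
          \<ge> of_int (p Z)"
        by (simp only: of_int_le_iff)
      then show ?thesis using sum_y[OF Z] a by (auto split: if_splits)
    qed
    moreover have "sum y V = of_int (p V)"
      using sum_y[of V] uv m(1) unfolding base_polyhedron_def by auto
    ultimately show ?thesis using y_ext unfolding base_polyhedron_def by auto
  qed
  moreover have "sum y T < sum m T"
    using sum_y[OF \<open>T \<subseteq> V\<close>] u v by auto
  ultimately show False using min unfolding is_arg_min_def by blast
qed

text \<open>The three conditions are complementary slackness: they make every estimate in the lower
  bound for m(T) an equality.\<close>

lemma minimizer_dual_set:
  assumes "finite V" "supermodular_on V p" "p {} = 0" "T \<subseteq> V"
    and min: "is_arg_min (\<lambda>x. sum x T)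
        (\<lambda>x. x \<in> base_polyhedron V p \<inter> box_between V f g \<inter> integral_vectors V) m"
  shows "\<exists>X\<subseteq>V. sum m X = of_int (p X) \<and> (\<forall>v\<in>T - X. m v = of_int (f v)) \<and>
    (\<forall>v\<in>X - T. m v = of_int (g v))"
proof -
  define F where "F = {Z. Z \<subseteq> V \<and> sum m Z = of_int (p Z)}"
  \<comment> \<open>\<open>S\<close> collects the elements of \<open>T\<close> that the box allows
    to decrease, \<open>U\<close> those outside \<open>T\<close> that it allows to increase. If
    \<open>X\<close> contains \<open>S\<close> and misses \<open>U\<close>, then T - X has no
    element above \<open>f\<close> and X - T none below \<open>g\<close>.\<close>
  define S where "S = {v \<in> T. m v > of_int (f v)}"
  define U where "U = {u \<in> V - T. m u < of_int (g u)}"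
  have m: "m \<in> base_polyhedron V p" "m \<in> box_between V f g"
    using min unfolding is_arg_min_def by auto
  have "\<exists>X\<in>F. S \<subseteq> X \<and> X \<inter> U = {}"
  proof (rule lattice_family_separation)
    show "finite S" "finite U" "S \<subseteq> V"
      using assms(1,4) by (auto simp: S_def U_def intro: finite_subset)
    show "{} \<in> F" "V \<in> F" using assms(3) m(1) by (auto simp: F_def base_polyhedron_def)
    show "X \<inter> Y \<in> F" "X \<union> Y \<in> F" if "X \<in> F" "Y \<in> F" for X Y
      using that tight_inter_union[OF assms(1,2) m(1), of X Y] by (auto simp: F_def)
    show "\<exists>Z\<in>F. v \<in> Z \<and> u \<notin> Z" if "v \<in> S" "u \<in> U" for v u
      using tight_set_separates[OF assms(1,4) min, of v u] that by (auto simp: F_def S_def U_def)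
  qed
  then obtain X where X: "X \<in> F" "S \<subseteq> X" "X \<inter> U = {}" by blast
  have box: "of_int (f v) \<le> m v" "m v \<le> of_int (g v)" if "v \<in> V" for v
    using m(2) that by (auto simp: box_between_def)
  have "m v = of_int (f v)" if "v \<in> T - X" for v
    using that X(2) box(1)[of v] \<open>T \<subseteq> V\<close> by (force simp: S_def)
  moreover have "m v = of_int (g v)" if "v \<in> X - T" for v
    using that X(1,3) box(2)[of v] by (force simp: U_def F_def)
  ultimately show ?thesis using X(1) by (auto simp: F_def)
qed

text \<open>Weak duality: m(T) splits into three terms, each bounded separately. Equality in the
  total forces equality in each term, and then at each element of the two sums of box
  bounds.\<close>

lemma sum_ge_dual_bound:
  assumes "finite V" "T \<subseteq> V" "X \<subseteq> V"
    and "m \<in> base_polyhedron V p" "m \<in> box_between V f g"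
  shows "sum m T \<ge> of_int (p X + sum f (T - X) - sum g (X - T))"
    and "sum m T = of_int (p X + sum f (T - X) - sum g (X - T)) \<longleftrightarrow>
      sum m X = of_int (p X) \<and> (\<forall>v\<in>T - X. m v = of_int (f v)) \<and> (\<forall>v\<in>X - T. m v = of_int (g v))"
proof -
  let ?F = "\<Sum>v\<in>T - X. real_of_int (f v)" and ?G = "\<Sum>v\<in>X - T. real_of_int (g v)"
  have fin: "finite T" "finite X" using assms finite_subset by auto
  have split: "sum m T = sum m X + sum m (T - X) - sum m (X - T)"
    using sum.Int_Diff[of T m X] sum.Int_Diff[of X m T] fin by (simp add: Int_commute)
  have X: "sum m X \<ge> of_int (p X)" using assms unfolding base_polyhedron_def by auto
  have f: "of_int (f v) \<le> m v" if "v \<in> T - X" for v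
    using assms that unfolding box_between_def by auto
  have g: "m v \<le> of_int (g v)" if "v \<in> X - T" for v
    using assms that unfolding box_between_def by auto
  have F: "?F \<le> sum m (T - X)" and G: "sum m (X - T) \<le> ?G"
    using f g by (auto intro!: sum_mono)
  show "sum m T \<ge> of_int (p X + sum f (T - X) - sum g (X - T))"
    using split X F G by simp
  have F_eq: "sum m (T - X) = ?F \<longleftrightarrow> (\<forall>v\<in>T - X. m v = of_int (f v))"
    using sum_mono_inv[of "\<lambda>v. of_int (f v)" "T - X" m] f fin by (auto intro: sum.cong)
  have G_eq: "sum m (X - T) = ?G \<longleftrightarrow> (\<forall>v\<in>X - T. m v = of_int (g v))"
    using sum_mono_inv[of m "X - T" "\<lambda>v. of_int (g v)"] g fin by (auto intro: sum.cong)
  show "sum m T = of_int (p X + sum f (T - X) - sum g (X - T)) \<longleftrightarrow>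
      sum m X = of_int (p X) \<and> (\<forall>v\<in>T - X. m v = of_int (f v)) \<and> (\<forall>v\<in>X - T. m v = of_int (g v))"
    unfolding F_eq[symmetric] G_eq[symmetric] using split X F G by auto
qed

theorem theorem9p9:
  fixes V T :: "'a set" and p :: "'a set \<Rightarrow> int" and f g :: "'a \<Rightarrow> int"
  assumes "finite V" and "V \<noteq> {}"
    and "supermodular_on V p" and "p {} = 0"
    and "\<forall>v\<in>V. f v \<le> g v"
    and "base_polyhedron V p \<inter> box_between V f g \<inter> integral_vectors V \<noteq> {}"
    and "T \<subseteq> V"
  shows "\<exists>(f' :: 'a \<Rightarrow> int) (g' :: 'a \<Rightarrow> int) X\<^sub>T.
    box_between V f' g' \<subseteq> box_between V f g \<and> X\<^sub>T \<subseteq> V \<and>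
    (\<forall>m \<in> base_polyhedron V p \<inter> box_between V f g \<inter> integral_vectors V.
      is_arg_min (\<lambda>x. sum x T)
        (\<lambda>x. x \<in> base_polyhedron V p \<inter> box_between V f g \<inter> integral_vectors V) m \<longleftrightarrow>
      sum m X\<^sub>T = of_int (p X\<^sub>T) \<and>
      m \<in> base_polyhedron V p \<inter> box_between V f' g' \<inter> integral_vectors V)"
proof -
  let ?Q = "base_polyhedron V p \<inter> box_between V f g \<inter> integral_vectors V"
  obtain m0 where min0: "is_arg_min (\<lambda>x. sum x T) (\<lambda>x. x \<in> ?Q) m0"
    using exists_integral_minimizer[OF assms(1,7,6)] by blast
  then have m0: "m0 \<in> ?Q" unfolding is_arg_min_def by blast
  obtain X where X: "X \<subseteq> V" and dual: "sum m0 X = of_int (p X)"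
      "\<forall>v\<in>T - X. m0 v = of_int (f v)" "\<forall>v\<in>X - T. m0 v = of_int (g v)"
    using minimizer_dual_set[OF assms(1,3,4,7) min0] by blast
  \<comment> \<open>The new box pins the coordinates in X - T to \<open>g\<close> and those in T - X
    to \<open>f\<close>, and leaves all others alone. Since \<open>f \<le> g\<close>, this only
    raises lower bounds and lowers upper bounds.\<close>
  define f' where "f' v = (if v \<in> X - T then g v else f v)" for v
  define g' where "g' v = (if v \<in> T - X then f v else g v)" for v
  let ?d = "real_of_int (p X + sum f (T - X) - sum g (X - T))"
  note bound = sum_ge_dual_bound[OF assms(1,7) X]
  have attained: "sum m0 T = ?d" using bound(2)[of m0 p f g] m0 dual by blast
  have ff: "f v \<le> f' v \<and> g' v \<le> g v" if "v \<in> V" for v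
    using that assms(5) by (auto simp: f'_def g'_def)
  have sub: "box_between V f' g' \<subseteq> box_between V f g"
  proof
    fix x assume x: "x \<in> box_between V f' g'"
    have "of_int (f v) \<le> x v \<and> x v \<le> of_int (g v)" if "v \<in> V" for v
    proof -
      have "of_int (f' v) \<le> x v" "x v \<le> of_int (g' v)"
        using x that by (auto simp: box_between_def)
      moreover have "real_of_int (f v) \<le> of_int (f' v)" "real_of_int (g' v) \<le> of_int (g v)"
        using ff[OF that] by simp_all
      ultimately show ?thesis by linarith
    qed
    then show "x \<in> box_between V f g" using x by (auto simp: box_between_def)
  qed
  have "is_arg_min (\<lambda>x. sum x T) (\<lambda>x. x \<in> ?Q) m \<longleftrightarrow>
      sum m X = of_int (p X) \<and> m \<in> base_polyhedron V p \<inter> box_between V f' g' \<inter> integral_vectors V"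
    if m: "m \<in> ?Q" for m
  proof -
    \<comment> \<open>\<open>?d\<close> bounds the objective from below on \<open>?Q\<close> and is
      attained by \<open>m0\<close>, so it is the minimum value.\<close>
    have "is_arg_min (\<lambda>x. sum x T) (\<lambda>x. x \<in> ?Q) m \<longleftrightarrow> sum m T = ?d"
    proof
      assume "is_arg_min (\<lambda>x. sum x T) (\<lambda>x. x \<in> ?Q) m"
      then have "\<not> sum m0 T < sum m T" using m0 unfolding is_arg_min_def by blast
      then show "sum m T = ?d" using attained bound(1)[of m p f g] m by auto
    next
      assume eq: "sum m T = ?d"
      have "\<not> sum y T < sum m T" if "y \<in> ?Q" for y
        using bound(1)[of y p f g] that eq by auto
      then show "is_arg_min (\<lambda>x. sum x T) (\<lambda>x. x \<in> ?Q) m"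
        using m unfolding is_arg_min_def by blast
    qed
    also have "\<dots> \<longleftrightarrow> sum m X = of_int (p X) \<and>
        (\<forall>v\<in>T - X. m v = of_int (f v)) \<and> (\<forall>v\<in>X - T. m v = of_int (g v))"
      using bound(2)[of m p f g] m by blast
    also have "(\<forall>v\<in>T - X. m v = of_int (f v)) \<and> (\<forall>v\<in>X - T. m v = of_int (g v)) \<longleftrightarrow>
        m \<in> box_between V f' g'"
    proof
      assume "(\<forall>v\<in>T - X. m v = of_int (f v)) \<and> (\<forall>v\<in>X - T. m v = of_int (g v))"
      then show "m \<in> box_between V f' g'"
        using m by (auto simp: box_between_def f'_def g'_def)
    next
      assume m': "m \<in> box_between V f' g'"
      then have "of_int (f' v) \<le> m v" "m v \<le> of_int (g' v)" if "v \<in> V" for v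
        using that by (auto simp: box_between_def)
      \<comment> \<open>On T - X both new bounds equal \<open>f\<close>, on X - T both equal
        \<open>g\<close>, so antisymmetry fixes \<open>m\<close> there.\<close>
      from this[unfolded f'_def g'_def]
      show "(\<forall>v\<in>T - X. m v = of_int (f v)) \<and> (\<forall>v\<in>X - T. m v = of_int (g v))"
        using X assms(7) by (force intro: antisym)
    qed
    finally show ?thesis using m by blast
  qed
  then show ?thesis using sub X by blast
qed

end
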